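(* For every integer $r\geq 2$ there exists $c=c(r)>0$ such that the following holds. If $G$ is an $r$-line-graph with $n$ vertices that does not contain a tight cycle, then $\mathrm{dens}(G)\leq e^{c\sqrt{\log n}}$.
   Context: Let $A_1,\dots,A_r$ be pairwise disjoint finite sets. An $r$-line-graph is a graph $G$ whose vertex set is a set $V(G)\subset A_1\times\dots\times A_r$ of $r$-tuples, where two vertices are adjacent iff they differ in exactly one coordinate. Such $G$ is identified with the $r$-uniform hypergraph on $A_1\cup\dots\cup A_r$ whose edges are the sets $\{a_1,\dots,a_r\}$ with $(a_1,\dots,a_r)\in V(G)$; $G$ contains a tight cycle if this hypergraph does (a tight cycle of length $\ell\geq r+1$ being distinct vertices $x_1,\dots,x_\ell$ with all $\{x_i,\dots,x_{i+r-1}\}$, indices mod $\ell$, being edges). For $i\in[r]$, an $i$-block of $G$ is a maximal set of vertices of $G$ that pairwise differ only in the $i$-th coordinate (i.e. the set of all vertices agreeing with a given vertex $x$ in all coordinates other than the $i$-th); a block is an $i$-block for some $i$. If $p(G)$ is the number of blocks of $G$, the density is $\mathrm{dens}(G)=\frac{r|V(G)|}{p(G)}$. Here $\log$ is the natural logarithm. *)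

theory Defs
  imports Complex_Main "HOL-Library.FuncSet" "HOL-Library.Disjoint_Sets"
begin

text \<open>Coordinates are numbered \<open>0, \<dots>, r - 1\<close>. An \<open>r\<close>-tuple in \<open>A 0 \<times> \<dots> \<times> A (r - 1)\<close> is an
  element of the extensional product \<open>PiE {..<r} A\<close>, so that equality of tuples is equality of
  functions.\<close>

definition r_line_graph ::
  "nat \<Rightarrow> (nat \<Rightarrow> 'a set) \<Rightarrow> (nat \<Rightarrow> 'a) set \<Rightarrow> (nat \<Rightarrow> 'a) set set \<Rightarrow> bool" where
  "r_line_graph r A V E \<longleftrightarrow>
     (\<forall>i<r. finite (A i)) \<and>
     disjoint_family_on A {..<r} \<and>
     V \<subseteq> PiE {..<r} A \<and>
     E = {{x, y} | x y. x \<in> V \<and> y \<in> V \<and> (\<exists>!i. i < r \<and> x i \<noteq> y i)}"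

definition hyperedges :: "nat \<Rightarrow> (nat \<Rightarrow> 'a) set \<Rightarrow> 'a set set" where
  "hyperedges r V = (\<lambda>x. x ` {..<r}) ` V"

definition contains_tight_cycle :: "nat \<Rightarrow> 'a set set \<Rightarrow> bool" where
  "contains_tight_cycle r H \<longleftrightarrow>
     (\<exists>xs. r + 1 \<le> length xs \<and> distinct xs \<and>
        (\<forall>i<length xs. {xs ! ((i + j) mod length xs) | j. j < r} \<in> H))"

definition i_blocks :: "nat \<Rightarrow> nat \<Rightarrow> (nat \<Rightarrow> 'a) set \<Rightarrow> (nat \<Rightarrow> 'a) set set" where
  "i_blocks r i V = {{y \<in> V. \<forall>j<r. j \<noteq> i \<longrightarrow> y j = x j} | x. x \<in> V}"

text \<open>The blocks are exactly the maximal sets of vertices that pairwise differ only in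
  coordinate \<open>i\<close>.\<close>

lemma i_blocks_iff_maximal:
  assumes "V \<noteq> {}"
  shows "B \<in> i_blocks r i V \<longleftrightarrow>
    (let P = (\<lambda>C. C \<subseteq> V \<and> (\<forall>x\<in>C. \<forall>y\<in>C. \<forall>j<r. j \<noteq> i \<longrightarrow> x j = y j))
     in P B \<and> (\<forall>C. P C \<longrightarrow> B \<subseteq> C \<longrightarrow> C = B))"
proof -
  define P where "P = (\<lambda>C. C \<subseteq> V \<and> (\<forall>x\<in>C. \<forall>y\<in>C. \<forall>j<r. j \<noteq> i \<longrightarrow> x j = y j))"
  define cl where "cl = (\<lambda>x. {y \<in> V. \<forall>j<r. j \<noteq> i \<longrightarrow> y j = x j})"
  have Pcl: "P (cl x)" for x by (auto simp: P_def cl_def)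
  have sub: "C \<subseteq> cl x" if "P C" "x \<in> C" for C x using that by (auto simp: P_def cl_def)
  have mem: "x \<in> cl x" if "x \<in> V" for x using that by (auto simp: cl_def)
  have "B \<in> i_blocks r i V \<longleftrightarrow> (\<exists>x\<in>V. B = cl x)"
    unfolding i_blocks_def cl_def by blast
  also have "\<dots> \<longleftrightarrow> P B \<and> (\<forall>C. P C \<longrightarrow> B \<subseteq> C \<longrightarrow> C = B)"
  proof
    assume "\<exists>x\<in>V. B = cl x"
    then show "P B \<and> (\<forall>C. P C \<longrightarrow> B \<subseteq> C \<longrightarrow> C = B)"
      using Pcl sub mem by blast
  next
    assume B: "P B \<and> (\<forall>C. P C \<longrightarrow> B \<subseteq> C \<longrightarrow> C = B)"
    obtain v where v: "v \<in> V" using assms by blast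
    have "B \<noteq> {}" using B Pcl[of v] mem[OF v] by blast
    then obtain x where x: "x \<in> B" by blast
    have "x \<in> V" using B x by (auto simp: P_def)
    moreover have "cl x = B" using B Pcl[of x] sub[of B x] x by blast
    ultimately show "\<exists>x\<in>V. B = cl x" by blast
  qed
  finally show ?thesis by (simp add: P_def Let_def)
qed

text \<open>Blocks are counted together with their direction: a singleton \<open>{x}\<close> that is an \<open>i\<close>-block
  for several \<open>i\<close> counts once for each of them. Every vertex thus lies in exactly \<open>r\<close> blocks, and
  the density is the average block size.\<close>

definition num_blocks :: "nat \<Rightarrow> (nat \<Rightarrow> 'a) set \<Rightarrow> nat" where
  "num_blocks r V = (\<Sum>i<r. card (i_blocks r i V))"

definition dens :: "nat \<Rightarrow> (nat \<Rightarrow> 'a) set \<Rightarrow> real" where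
  "dens r V = real (r * card V) / real (num_blocks r V)"

end

theory Submission
  imports Defs
begin

text \<open>
  The bound obtained is in fact polylogarithmic in \<open>n\<close>. Pass to a subset \<open>V\<close> of the vertices maximising
  \<open>card X / (p X * (M + ln (card X)))\<close>, where \<open>p\<close> counts blocks and \<open>M = 1 + ln n\<close>. This costs a
  factor of at most 2 in density; all blocks of \<open>V\<close> are large, and every \<open>X\<close> with at most
  15/16 of the vertices expands: the blocks meeting \<open>X\<close> cover at least
  \<open>(1 + 1 / (32 * M)) * card X\<close> vertices.

  Hence, from any vertex \<open>e\<close>, tight paths of length \<open>O(M\<^sup>2)\<close> avoiding any given set of
  polylogarithmically many elements reach 7/8 of all vertices, because a path extends to all but few
  vertices of every block it enters. Avoiding overused elements, one chooses paths from \<open>e\<close> to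
  7/8 of the vertices such that every element lies on few of them. For a random triple \<open>e, f, g\<close>
  consider the chosen paths from \<open>e\<close> to \<open>f\<close>, from \<open>f\<close> to \<open>g\<close> and from \<open>g\<close> to \<open>e\<close>. Once \<open>e\<close> and
  \<open>f\<close> are fixed, so is the first path, while the second still has a random endpoint and is
  therefore unlikely to meet it; the same holds for the other two pairs. So some triple yields
  three disjoint paths, and these form a tight cycle.
\<close>

section \<open>Extremal subsets\<close>

text \<open>Overwriting coordinate \<open>i\<close> by a fixed value forgets it, so on extensional
  tuples the \<open>i\<close>-blocks are the nonempty fibres of \<open>key i\<close>, and counting
  blocks becomes counting keys.\<close>

definition key :: "nat \<Rightarrow> (nat \<Rightarrow> 'a) \<Rightarrow> nat \<Rightarrow> 'a" where
  "key i x = x(i := undefined)"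

text \<open>For \<open>X\<close> inside \<open>V\<close> this is the union of all
  \<open>i\<close>-blocks of \<open>V\<close> that meet \<open>X\<close>; it contains
  \<open>X\<close> itself.\<close>

definition nbr :: "nat \<Rightarrow> (nat \<Rightarrow> 'a) set \<Rightarrow> (nat \<Rightarrow> 'a) set \<Rightarrow> (nat \<Rightarrow> 'a) set" where
  "nbr i V X = {y \<in> V. key i y \<in> key i ` X}"

definition key_count :: "nat \<Rightarrow> (nat \<Rightarrow> 'a) set \<Rightarrow> nat" where
  "key_count r V = (\<Sum>i<r. card (key i ` V))"

lemma key_eq_iff:
  assumes "x \<in> extensional {..<r}" "y \<in> extensional {..<r}"
  shows "key i y = key i x \<longleftrightarrow> (\<forall>j<r. j \<noteq> i \<longrightarrow> y j = x j)"
proof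
  assume "key i y = key i x"
  then show "\<forall>j<r. j \<noteq> i \<longrightarrow> y j = x j"
    unfolding key_def by (metis fun_upd_other)
next
  assume eq: "\<forall>j<r. j \<noteq> i \<longrightarrow> y j = x j"
  have "key i y j = key i x j" for j
    using eq assms by (cases "j < r") (auto simp: key_def extensional_def)
  then show "key i y = key i x" by blast
qed

lemma num_blocks_eq_key_count:
  assumes "V \<subseteq> extensional {..<r}"
  shows "num_blocks r V = key_count r V"
  unfolding num_blocks_def key_count_def
proof (rule sum.cong[OF refl])
  fix i
  have "i_blocks r i V = (\<lambda>x. {y \<in> V. \<forall>j<r. j \<noteq> i \<longrightarrow> y j = x j}) ` V"
    by (auto simp: i_blocks_def)
  also have "\<dots> = (\<lambda>x. {y \<in> V. key i y = key i x}) ` V"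
    using assms key_eq_iff[of _ r _ i] by (intro image_cong) blast+
  also have "\<dots> = (\<lambda>k. {y \<in> V. key i y = k}) ` key i ` V"
    by (simp add: image_image)
  finally have "i_blocks r i V = (\<lambda>k. {y \<in> V. key i y = k}) ` key i ` V" .
  moreover have "inj_on (\<lambda>k. {y \<in> V. key i y = k}) (key i ` V)"
    by (rule inj_onI) blast
  ultimately show "card (i_blocks r i V) = card (key i ` V)"
    by (simp add: card_image)
qed

lemma key_count_pos:
  assumes "finite V" "V \<noteq> {}" "r > 0"
  shows "key_count r V \<ge> r"
proof -
  have "(\<Sum>i<r. 1) \<le> (\<Sum>i<r. card (key i ` V))"
    using assms by (intro sum_mono) (simp add: Suc_le_eq card_gt_0_iff)
  then show ?thesis by (simp add: key_count_def)
qed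

section \<open>Maximisers of density with a logarithmic weight\<close>

text \<open>Maximality of \<open>card X / (key_count r X * (M + ln (card X)))\<close> at
  \<open>X = V\<close>, cross-multiplied to avoid division.\<close>

definition extremal :: "nat \<Rightarrow> real \<Rightarrow> (nat \<Rightarrow> 'a) set \<Rightarrow> bool" where
  "extremal r M V \<longleftrightarrow> finite V \<and> V \<noteq> {} \<and>
     (\<forall>X\<subseteq>V. X \<noteq> {} \<longrightarrow>
        real (card X) * real (key_count r V) * (M + ln (real (card V)))
          \<le> real (card V) * real (key_count r X) * (M + ln (real (card X))))"

text \<open>On nonempty subsets the weight \<open>M + ln (card X)\<close> stays between
  \<open>M\<close> and \<open>2 * M\<close>, so a maximiser of the weighted ratio loses at most a
  factor 2 in the unweighted one.\<close>

lemma extremal_subset: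
  fixes V :: "(nat \<Rightarrow> 'a) set"
  assumes fin: "finite V" and ne: "V \<noteq> {}" and r: "r > 0" and M: "M > 0" "ln (real (card V)) \<le> M"
  obtains W where "W \<subseteq> V" "extremal r M W"
    "real (card V) * real (key_count r W) \<le> 2 * real (card W) * real (key_count r V)"
proof -
  define \<phi> where
    "\<phi> X = real (card X) / (real (key_count r X) * (M + ln (real (card X))))" for X :: "(nat \<Rightarrow> 'a) set"
  have g: "M + ln (real (card X)) \<ge> M" "real (key_count r X) > 0" if "X \<subseteq> V" "X \<noteq> {}" for X
  proof -
    have X: "finite X" using that fin finite_subset by blast
    then have "card X \<ge> 1" using that by (simp add: Suc_le_eq card_gt_0_iff)
    then show "M + ln (real (card X)) \<ge> M" by simp
    show "real (key_count r X) > 0" using key_count_pos[OF X that(2) r] r by simp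
  qed
  define \<X> where "\<X> = Pow V - {{}}"
  have "finite \<X>" "\<X> \<noteq> {}" using fin ne by (auto simp: \<X>_def)
  then have "Max (\<phi> ` \<X>) \<in> \<phi> ` \<X>" by simp
  then obtain W where W: "W \<in> \<X>" "\<phi> W = Max (\<phi> ` \<X>)" by fastforce
  have W_max: "\<phi> X \<le> \<phi> W" if "X \<in> \<X>" for X
    using that W(2) \<open>finite \<X>\<close> by simp
  have WV: "W \<subseteq> V" "W \<noteq> {}" using W by (auto simp: \<X>_def)
  have le: "real (card X) * real (key_count r W) * (M + ln (real (card W)))
          \<le> real (card W) * real (key_count r X) * (M + ln (real (card X)))"
    if "X \<subseteq> V" "X \<noteq> {}" for X
  proof -
    have "\<phi> X \<le> \<phi> W" using W_max that by (auto simp: \<X>_def)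
    moreover have "real (key_count r X) * (M + ln (real (card X))) > 0"
      "real (key_count r W) * (M + ln (real (card W))) > 0"
      using g[OF that] g[OF WV] M by (simp_all add: mult_pos_pos)
    ultimately show ?thesis by (simp add: \<phi>_def divide_simps mult.assoc)
  qed
  have ext: "extremal r M W"
    unfolding extremal_def using le WV fin finite_subset[OF WV(1) fin] by (meson subset_trans)
  have "real (card V) * real (key_count r W) * M
        \<le> real (card V) * real (key_count r W) * (M + ln (real (card W)))"
    using g[OF WV] by (intro mult_left_mono) auto
  also have "\<dots> \<le> real (card W) * real (key_count r V) * (M + ln (real (card V)))"
    using le[OF subset_refl ne] .
  also have "\<dots> \<le> real (card W) * real (key_count r V) * (2 * M)"
    using M by (intro mult_left_mono) auto
  finally have "real (card V) * real (key_count r W) \<le> 2 * real (card W) * real (key_count r V)"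
    using M by simp
  then show ?thesis using that WV ext by blast
qed

text \<open>The weight of \<open>X\<close> is at most that of \<open>V\<close>, so it can be
  cancelled from the extremal inequality.\<close>

lemma extremal_sparse:
  assumes ext: "extremal r M V" and X: "X \<subseteq> V" and M: "M > 0"
  shows "real (card X) * real (key_count r V) \<le> real (card V) * real (key_count r X)"
proof (cases "X = {}")
  case False
  have fin: "finite V" "finite X" using ext finite_subset[OF X] by (auto simp: extremal_def)
  have X1: "card X \<ge> 1" using False fin by (simp add: Suc_le_eq card_gt_0_iff)
  have XV: "card X \<le> card V" using X fin by (simp add: card_mono)
  let ?g = "M + ln (real (card V))"
  have g: "?g > 0" using X1 XV M by (simp add: add_pos_nonneg)
  have "real (card X) * real (key_count r V) * ?g
      \<le> real (card V) * real (key_count r X) * (M + ln (real (card X)))"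
    using ext X False by (auto simp: extremal_def)
  also have "\<dots> \<le> real (card V) * real (key_count r X) * ?g"
    using X1 XV by (intro mult_left_mono) auto
  finally show ?thesis using g by simp
qed simp

text \<open>Deleting a block with fewer than \<open>card V / key_count r V\<close> vertices also
  deletes a key in direction \<open>i\<close>, and would leave a set denser than
  \<open>V\<close>.\<close>

lemma extremal_block_size:
  assumes ext: "extremal r M V" and M: "M > 0" and x: "x \<in> V" and i: "i < r"
  shows "real (card V) \<le> real (key_count r V) * real (card {y \<in> V. key i y = key i x})"
proof -
  define B where "B = {y \<in> V. key i y = key i x}"
  have fin: "finite V" using ext by (simp add: extremal_def)
  have "key i x \<notin> key i ` (V - B)" by (auto simp: B_def)
  then have "key i ` (V - B) \<subset> key i ` V" using x by blast
  then have "card (key i ` (V - B)) < card (key i ` V)"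
    by (rule psubset_card_mono[rotated]) (simp add: fin)
  then have "key_count r (V - B) < key_count r V"
    unfolding key_count_def using i
    by (intro sum_strict_mono_ex1) (auto intro: card_mono image_mono simp: fin)
  then have "real (key_count r (V - B)) + 1 \<le> real (key_count r V)" by linarith
  then have "real (card V) * (real (key_count r (V - B)) + 1) \<le> real (card V) * real (key_count r V)"
    by (intro mult_left_mono) auto
  moreover have "real (card (V - B)) * real (key_count r V) \<le> real (card V) * real (key_count r (V - B))"
    using extremal_sparse[OF ext _ M] by blast
  moreover have "real (card (V - B)) = real (card V) - real (card B)"
    using fin by (subst card_Diff_subset) (auto simp: B_def of_nat_diff card_mono)
  ultimately show ?thesis unfolding B_def[symmetric] by (simp add: algebra_simps)
qed

lemma key_count_add_le:
  assumes fin: "finite V" and sub: "X \<subseteq> V" "Y \<subseteq> V"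
    and disj: "\<And>i. i < r \<Longrightarrow> key i ` X \<inter> key i ` Y = {}"
  shows "key_count r X + key_count r Y \<le> key_count r V"
proof -
  have finXY: "finite X" "finite Y" using sub fin finite_subset by metis+
  have "card (key i ` X) + card (key i ` Y) \<le> card (key i ` V)" if i: "i < r" for i
  proof -
    have "card (key i ` X) + card (key i ` Y) = card (key i ` X \<union> key i ` Y)"
      using disj[OF i] finXY by (simp add: card_Un_disjoint)
    also have "\<dots> \<le> card (key i ` V)"
      using sub by (intro card_mono finite_imageI fin) blast
    finally show ?thesis .
  qed
  then have "(\<Sum>i<r. card (key i ` X) + card (key i ` Y)) \<le> (\<Sum>i<r. card (key i ` V))"
    by (intro sum_mono) simp
  then show ?thesis by (simp add: key_count_def sum.distrib)
qed

lemma key_disjoint_nbr: "key i ` X \<inter> key i ` (V - nbr i V X) = {}"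
  by (auto simp: nbr_def intro: rev_image_eqI)

text \<open>The vertices of \<open>X\<close> and those sharing no block with \<open>X\<close> meet disjoint sets of blocks. Neither
  part is denser than \<open>V\<close>, and \<open>X\<close> is noticeably sparser, so many vertices lie in neither part.\<close>

lemma extremal_expands:
  assumes ext: "extremal r M V" and r: "r > 0" and M: "M > 0" "ln (real (card V)) \<le> M"
    and X: "X \<subseteq> V" "16 * card X \<le> 15 * card V"
  shows "(1 + 1 / (32 * M)) * real (card X) \<le> real (card (\<Union>i<r. nbr i V X))"
proof (cases "X = {}")
  case False
  have fin: "finite V" "finite X" using ext finite_subset[OF X(1)] by (auto simp: extremal_def)
  have ne: "V \<noteq> {}" using ext by (simp add: extremal_def)
  have X1: "card X \<ge> 1" using False fin by (simp add: Suc_le_eq card_gt_0_iff)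
  have XV: "card X \<le> card V" using X fin by (simp add: card_mono)
  let ?N = "\<Union>i<r. nbr i V X"
  let ?Y = "V - ?N"
  let ?P = "real (key_count r V)" and ?n = "real (card V)" and ?x = "real (card X)"
  let ?gX = "M + ln ?x" and ?gV = "M + ln ?n"
  have P: "?P > 0" using key_count_pos[OF fin(1) ne r] r by simp
  have "0 \<le> ln ?x" "ln ?x \<le> ln ?n" using X1 XV by auto
  then have gX: "?gX > 0" "?gX \<le> 2 * M" using M by linarith+
  \<comment> \<open>Here the bound 15/16 enters: the weight of \<open>V\<close> exceeds that of
    \<open>X\<close> by at least 1/16.\<close>
  have "ln (?n / ?x) \<ge> 1 - ?x / ?n"
    using X1 XV ln_le_minus_one[of "?x / ?n"]
    by (simp add: ln_div)
  moreover have "1 - ?x / ?n \<ge> 1 / 16" using X X1 XV by (simp add: field_simps)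
  ultimately have ln16: "?gV \<ge> ?gX + 1 / 16" using X1 XV by (simp add: ln_div)
  \<comment> \<open>As \<open>?gX\<close> is at most \<open>2 * M\<close>, the factor
    \<open>1 + 1 / (32 * M)\<close> adds at most 1/16 to it, which the gap between the weights pays
    for.\<close>
  have "(1 + 1 / (32 * M)) * ?gX \<le> ?gX + (1 / (32 * M)) * (2 * M)"
    using gX M by (simp add: field_simps)
  also have "\<dots> = ?gX + 1 / 16" using M by simp
  finally have ratio: "(1 + 1 / (32 * M)) * ?gX \<le> ?gV" using ln16 by simp
  have "(1 + 1 / (32 * M)) * ?x * ?P * ?gX = ?x * ?P * ((1 + 1 / (32 * M)) * ?gX)"
    by (simp add: mult_ac)
  also have "\<dots> \<le> ?x * ?P * ?gV" using ratio by (intro mult_left_mono) auto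
  also have "\<dots> \<le> ?n * real (key_count r X) * ?gX"
    using ext X False by (auto simp: extremal_def)
  finally have 1: "(1 + 1 / (32 * M)) * ?x * ?P \<le> ?n * real (key_count r X)"
    using gX by simp
  have 2: "real (card ?Y) * ?P \<le> ?n * real (key_count r ?Y)"
    using extremal_sparse[OF ext _ M(1)] by blast
  have "key i ` X \<inter> key i ` ?Y = {}" if "i < r" for i
  proof -
    have "key i ` ?Y \<subseteq> key i ` (V - nbr i V X)"
      using that by (intro image_mono) auto
    with key_disjoint_nbr[of i X V] show ?thesis by (meson disjoint_iff subsetD)
  qed
  then have "key_count r X + key_count r ?Y \<le> key_count r V"
    by (rule key_count_add_le[OF fin(1) X(1) Diff_subset])
  then have "?n * (real (key_count r X) + real (key_count r ?Y)) \<le> ?n * ?P"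
    by (intro mult_left_mono) linarith+
  with 1 2 have "((1 + 1 / (32 * M)) * ?x + real (card ?Y)) * ?P \<le> ?n * ?P"
    by (simp add: algebra_simps)
  then have "(1 + 1 / (32 * M)) * ?x + real (card ?Y) \<le> ?n" using P by simp
  moreover have "?N \<subseteq> V" by (auto simp: nbr_def)
  then have "real (card ?Y) = ?n - real (card ?N)"
    using fin by (subst card_Diff_subset) (auto simp: card_mono dest: finite_subset)
  ultimately show ?thesis by linarith
qed simp

text \<open>The blocks meeting \<open>T\<close> partition \<open>nbr i V T\<close>. Each has at
  least \<open>D\<close> vertices and loses at most \<open>\<delta> * D\<close> of them, so the
  relative loss carries over to the union.\<close>

lemma card_nbr_diff_le:
  assumes fin: "finite V" and T: "T \<subseteq> V" and \<delta>: "\<delta> \<ge> 0"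
    and D: "\<And>x. x \<in> V \<Longrightarrow> D \<le> real (card {y \<in> V. key i y = key i x})"
    and f: "\<And>x. x \<in> T \<Longrightarrow> real (card ({y \<in> V. key i y = key i x} - T')) \<le> \<delta> * D"
  shows "real (card (nbr i V T - T')) \<le> \<delta> * real (card (nbr i V T))"
proof -
  let ?B = "\<lambda>k. {y \<in> V. key i y = k}"
  have fink: "finite (key i ` T)" using fin T finite_subset by blast
  have "nbr i V T = (\<Union>k\<in>key i ` T. ?B k)" by (auto simp: nbr_def)
  then have card_nbr: "card (nbr i V T) = (\<Sum>k\<in>key i ` T. card (?B k))"
    by (simp only:) (rule card_UN_disjoint, use fin fink in auto)
  have "nbr i V T - T' = (\<Union>k\<in>key i ` T. ?B k - T')" by (auto simp: nbr_def)
  then have "card (nbr i V T - T') \<le> (\<Sum>k\<in>key i ` T. card (?B k - T'))"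
    using card_UN_le[OF fink, of "\<lambda>k. ?B k - T'"] by (simp only:)
  then have "real (card (nbr i V T - T')) \<le> (\<Sum>k\<in>key i ` T. real (card (?B k - T')))"
    by (simp flip: of_nat_sum)
  also have "\<dots> \<le> (\<Sum>k\<in>key i ` T. \<delta> * real (card (?B k)))"
  proof (rule sum_mono)
    fix k assume "k \<in> key i ` T"
    then obtain x where x: "x \<in> T" "k = key i x" by blast
    have "real (card (?B k - T')) \<le> \<delta> * D" using f x by simp
    also have "\<dots> \<le> \<delta> * real (card (?B k))" using D x T \<delta> by (intro mult_left_mono) auto
    finally show "real (card (?B k - T')) \<le> \<delta> * real (card (?B k))" .
  qed
  finally show ?thesis by (simp add: card_nbr sum_distrib_left)
qed

section \<open>Growth of sets of vertices\<close>

text \<open>Any \<open>r\<close> consecutive steps of a walk use every direction.\<close>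

lemma add_mod_surj:
  fixes i r t :: nat
  assumes "i < r"
  obtains k where "k < r" "(t + k) mod r = i"
proof
  show "(r - t mod r + i) mod r < r" using assms by simp
  have "(t + (r - t mod r + i) mod r) mod r = (t mod r + (r - t mod r + i)) mod r"
    by (simp add: mod_simps)
  also have "t mod r + (r - t mod r + i) = r + i"
    using mod_less_divisor[of r t] assms by linarith
  finally show "(t + (r - t mod r + i) mod r) mod r = i" using assms by simp
qed

lemma subset_nbr: "X \<subseteq> V \<Longrightarrow> X \<subseteq> nbr i V X"
  by (auto simp: nbr_def)

lemma nbr_mono: "X \<subseteq> Y \<Longrightarrow> nbr i V X \<subseteq> nbr i V Y"
  by (auto simp: nbr_def)

lemma finite_nbr: "finite V \<Longrightarrow> finite (nbr i V X)"
  by (simp add: nbr_def)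

text \<open>If none of the next \<open>r\<close> sets is noticeably larger than \<open>T t\<close>, these sets almost agree, so
  their intersection is a nearly closed set in all \<open>r\<close> directions at once.\<close>

lemma growth_round:
  assumes ext: "extremal r M V" and r2: "r \<ge> 2" and M: "M \<ge> 1" "ln (real (card V)) \<le> M"
    and mu: "\<mu> = 1 / (512 * real r * M)" and de: "\<delta> = \<mu> / real r"
    and T: "\<And>k. T k \<subseteq> V" and ne: "T t \<noteq> {}" and small: "16 * card (T t) \<le> 15 * card V"
    and loss: "\<And>k. k < r \<Longrightarrow> real (card (nbr ((t + k) mod r) V (T (t + k)) - T (Suc (t + k))))
                  \<le> \<delta> * real (card (nbr ((t + k) mod r) V (T (t + k))))"
  shows "\<exists>k\<le>r. (1 + \<mu>) * real (card (T t)) \<le> real (card (T (t + k)))"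
proof (rule ccontr)
  assume "\<not> ?thesis"
  then have slow: "real (card (T (t + k))) < (1 + \<mu>) * real (card (T t))" if "k \<le> r" for k
    using that by (meson not_le)
  define N where "N k = nbr ((t + k) mod r) V (T (t + k))" for k
  define X where "X = (\<Inter>k\<in>{..r}. T (t + k))"
  let ?a = "real (card (T t))"
  have fin: "finite V" using ext by (simp add: extremal_def)
  have finT: "finite (T k)" for k using T fin finite_subset by metis
  have finN: "finite (N k)" for k using fin by (simp add: N_def finite_nbr)
  have a: "?a > 0" using ne finT by (simp add: card_gt_0_iff)
  have r: "r > 0" and r1: "real r \<ge> 1" using r2 by auto
  have mu0: "\<mu> > 0" using r M by (simp add: mu)
  have "512 * 1 * 1 \<le> 512 * real r * M" using r1 M by (intro mult_mono) auto
  then have mu1: "\<mu> \<le> 1 / 512" using r1 M by (simp add: mu field_simps)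
  have de0: "\<delta> > 0" "real r * \<delta> = \<mu>" using mu0 r by (auto simp: de)
  have deN: "real (card (N k)) * (1 - \<delta>) \<le> real (card (T (t + Suc k)))" if "k < r" for k
  proof -
    have "card (N k) \<le> card (N k - T (t + Suc k)) + card (T (t + Suc k))"
      using diff_card_le_card_Diff[OF finT, of "N k" "t + Suc k"] by linarith
    moreover have "real (card (N k - T (t + Suc k))) \<le> \<delta> * real (card (N k))"
      using loss[OF that] by (simp add: N_def)
    ultimately show ?thesis by (simp add: algebra_simps)
  qed
  \<comment> \<open>As \<open>r \<ge> 2\<close>, \<open>\<delta>\<close> is at most
    \<open>\<mu> / 2\<close>; hence \<open>(1 + \<mu>) / (1 - \<delta>)\<close> is at most
    \<open>1 + 2 * \<mu>\<close>.\<close>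
  have cardN: "real (card (N k)) \<le> (1 + 2 * \<mu>) * ?a" if "k < r" for k
  proof -
    have \<delta>: "\<delta> \<le> \<mu> / 2" unfolding de using mu0 r2 by (intro divide_left_mono) auto
    have "\<mu> * \<delta> \<le> \<mu> * (\<mu> / 2)" using \<delta> mu0 by (intro mult_left_mono) auto
    moreover have "\<mu> * \<mu> \<le> (1 / 2) * \<mu>" using mu0 mu1 by (intro mult_right_mono) auto
    ultimately have "1 + \<mu> \<le> (1 + 2 * \<mu>) * (1 - \<delta>)" using \<delta> by (simp add: algebra_simps)
    have "real (card (N k)) * (1 - \<delta>) \<le> (1 + \<mu>) * ?a"
      using deN[OF that] slow[of "Suc k"] that by simp
    also have "\<dots> \<le> ((1 + 2 * \<mu>) * (1 - \<delta>)) * ?a"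
      using \<open>1 + \<mu> \<le> (1 + 2 * \<mu>) * (1 - \<delta>)\<close> by (intro mult_right_mono) auto
    finally have "real (card (N k)) * (1 - \<delta>) \<le> ((1 + 2 * \<mu>) * ?a) * (1 - \<delta>)"
      by (simp add: mult_ac)
    then show ?thesis using \<delta> mu1 by simp
  qed
  have XT: "X \<subseteq> T (t + k)" if "k \<le> r" for k
    using that by (auto simp: X_def)
  have finX: "finite X" using XT[of 0] finT finite_subset by auto
  \<comment> \<open>A vertex of \<open>T t\<close> outside \<open>X\<close> has a first time at
    which it drops out. Just before, it lay in some \<open>T (t + j)\<close>, hence in
    \<open>N j\<close>, so it is among the losses of step \<open>j\<close>.\<close>
  have "T t - X \<subseteq> (\<Union>k<r. N k - T (t + Suc k))"
  proof
    fix x assume x: "x \<in> T t - X"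
    then have ex: "\<exists>k. k \<le> r \<and> x \<notin> T (t + k)" by (auto simp: X_def)
    define k where "k = (LEAST k. k \<le> r \<and> x \<notin> T (t + k))"
    have k: "k \<le> r" "x \<notin> T (t + k)" using LeastI_ex[OF ex] by (auto simp: k_def)
    have "k \<noteq> 0" using k x by (metis Diff_iff add_0_right)
    then obtain j where j: "k = Suc j" by (meson not0_implies_Suc)
    have "x \<in> T (t + j)"
      using not_less_Least[of j "\<lambda>k. k \<le> r \<and> x \<notin> T (t + k)"] k j by (auto simp: k_def[symmetric])
    then have "x \<in> N j" using subset_nbr[OF T] by (auto simp: N_def)
    then show "x \<in> (\<Union>k<r. N k - T (t + Suc k))" using k j by auto
  qed
  then have "card (T t - X) \<le> card (\<Union>k<r. N k - T (t + Suc k))"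
    using finN by (intro card_mono) auto
  also have "\<dots> \<le> (\<Sum>k<r. card (N k - T (t + Suc k)))" by (rule card_UN_le) simp
  finally have "real (card (T t - X)) \<le> (\<Sum>k<r. real (card (N k - T (t + Suc k))))"
    by (simp flip: of_nat_sum)
  also have "\<dots> \<le> (\<Sum>k<r. \<delta> * (2 * ?a))"
  proof (rule sum_mono)
    fix k assume "k \<in> {..<r}"
    then have k: "k < r" by simp
    have "real (card (N k - T (t + Suc k))) \<le> \<delta> * real (card (N k))"
      using loss[OF k] by (simp add: N_def)
    also have "(1 + 2 * \<mu>) * ?a \<le> 2 * ?a" using mu1 a by (intro mult_right_mono) auto
    then have "\<delta> * real (card (N k)) \<le> \<delta> * (2 * ?a)"
      using cardN[OF k] de0 by (intro mult_left_mono) auto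
    finally show "real (card (N k - T (t + Suc k))) \<le> \<delta> * (2 * ?a)" .
  qed
  also have "\<dots> = 2 * (real r * \<delta>) * ?a" by simp
  also have "\<dots> = 2 * \<mu> * ?a" by (simp only: de0)
  finally have "real (card (T t - X)) \<le> 2 * \<mu> * ?a" .
  moreover have "card (T t - X) = card (T t) - card X" "card X \<le> card (T t)"
    using XT[of 0] finX finT by (auto simp: card_Diff_subset card_mono)
  ultimately have X_ge: "real (card X) \<ge> (1 - 2 * \<mu>) * ?a" and X_le: "real (card X) \<le> ?a"
    by (auto simp: of_nat_diff algebra_simps)
  \<comment> \<open>Each direction is that of some \<open>N k\<close>, and \<open>X\<close> lies in
    every \<open>T (t + k)\<close>, so the neighbours of \<open>X\<close> lie in the sets
    \<open>N k\<close>, each of which exceeds \<open>X\<close> by at most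
    \<open>4 * \<mu> * ?a\<close>.\<close>
  have "(\<Union>i<r. nbr i V X) \<subseteq> X \<union> (\<Union>k<r. N k - X)"
  proof
    fix x assume "x \<in> (\<Union>i<r. nbr i V X)"
    then obtain i where i: "i < r" "x \<in> nbr i V X" by blast
    obtain k where k: "k < r" "(t + k) mod r = i" using add_mod_surj[OF i(1)] by blast
    have "x \<in> N k" using nbr_mono[OF XT, of k] i k by (auto simp: N_def)
    then show "x \<in> X \<union> (\<Union>k<r. N k - X)" using k by auto
  qed
  then have "card (\<Union>i<r. nbr i V X) \<le> card (X \<union> (\<Union>k<r. N k - X))"
    using finN finX by (intro card_mono) auto
  also have "\<dots> \<le> card X + card (\<Union>k<r. N k - X)" by (rule card_Un_le)
  also have "\<dots> \<le> card X + (\<Sum>k<r. card (N k - X))" by (intro add_left_mono card_UN_le) simp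
  finally have "real (card (\<Union>i<r. nbr i V X)) \<le> real (card X) + (\<Sum>k<r. real (card (N k - X)))"
    by (simp flip: of_nat_sum of_nat_add)
  also have "(\<Sum>k<r. real (card (N k - X))) \<le> (\<Sum>k<r. 4 * \<mu> * ?a)"
  proof (rule sum_mono)
    fix k assume "k \<in> {..<r}"
    then have k: "k < r" by simp
    have "X \<subseteq> N k" using XT[of k] subset_nbr[OF T] k by (auto simp: N_def)
    then have "real (card (N k - X)) = real (card (N k)) - real (card X)"
      using finX finN by (simp add: card_Diff_subset card_mono)
    also have "\<dots> \<le> (1 + 2 * \<mu>) * ?a - (1 - 2 * \<mu>) * ?a" using cardN[OF k] X_ge by linarith
    finally show "real (card (N k - X)) \<le> 4 * \<mu> * ?a" by (simp add: algebra_simps)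
  qed
  finally have up: "real (card (\<Union>i<r. nbr i V X)) \<le> real (card X) + 4 * real r * \<mu> * ?a"
    by simp
  have "X \<subseteq> V" using XT[of 0] T by fastforce
  moreover have "16 * card X \<le> 15 * card V" using X_le small by linarith
  ultimately have "(1 + 1 / (32 * M)) * real (card X) \<le> real (card (\<Union>i<r. nbr i V X))"
    using extremal_expands[OF ext r _ M(2)] M by auto
  \<comment> \<open>This is what 512 is chosen for: \<open>X\<close> must gain
    \<open>16 * r * \<mu> * card X\<close> but gains at most \<open>4 * r * \<mu> * ?a\<close>. So
    \<open>X\<close> has at most a quarter of the vertices of \<open>T t\<close>, although it has at
    least half.\<close>
  moreover have "1 / (32 * M) = 16 * real r * \<mu>" using M r by (simp add: mu field_simps)
  ultimately have "(1 + 16 * real r * \<mu>) * real (card X) \<le> real (card (\<Union>i<r. nbr i V X))"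
    by (simp only:)
  then have "(4 * real r * \<mu>) * (4 * real (card X)) \<le> (4 * real r * \<mu>) * ?a"
    using up by (simp add: algebra_simps)
  then have "4 * real (card X) \<le> ?a" using mu0 r by simp
  moreover have "(1 - 2 * \<mu>) * ?a \<ge> (1 / 2) * ?a" using mu1 a by (intro mult_right_mono) auto
  ultimately show False using X_ge a by linarith
qed

text \<open>Each round of at most \<open>r\<close> steps gains a factor \<open>1 + \<mu>\<close>
  until 15/16 of \<open>V\<close> is exceeded, and \<open>m\<close> rounds suffice for this. One
  further round moves on to a time divisible by \<open>r\<close>, and the loss in it still leaves
  7/8.\<close>

lemma growth:
  assumes ext: "extremal r M V" and r2: "r \<ge> 2" and M: "M \<ge> 1" "ln (real (card V)) \<le> M"
    and mu: "\<mu> = 1 / (512 * real r * M)" and de: "\<delta> = \<mu> / real r"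
    and m: "2 * M / \<mu> \<le> real m"
    and T: "\<And>k. T k \<subseteq> V" and ne: "T 0 \<noteq> {}"
    and loss: "\<And>k. k < (m + 1) * r \<Longrightarrow> real (card (nbr (k mod r) V (T k) - T (Suc k)))
                  \<le> \<delta> * real (card (nbr (k mod r) V (T k)))"
  shows "\<exists>t<(m + 1) * r. r dvd t \<and> 7 * card V \<le> 8 * card (T t)"
proof -
  have fin: "finite V" and neV: "V \<noteq> {}" using ext by (auto simp: extremal_def)
  have finT: "finite (T k)" for k using T fin finite_subset by metis
  have r: "r > 0" and r1: "real r \<ge> 1" using r2 by auto
  have mu0: "\<mu> > 0" using r M by (simp add: mu)
  have "512 * 1 * 1 \<le> 512 * real r * M" using r1 M by (intro mult_mono) auto
  then have mu1: "\<mu> \<le> 1 / 512" using r1 M by (simp add: mu field_simps)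
  have de0: "\<delta> > 0" "real r * \<delta> = \<mu>" using mu0 r by (auto simp: de)
  have step: "(\<exists>t\<le>j * r. 15 * card V < 16 * card (T t)) \<or> (\<exists>t\<le>j * r. (1 + \<mu>) ^ j \<le> real (card (T t)))"
    if "j \<le> m" for j
    using that
  proof (induction j)
    case 0
    then show ?case using ne finT by (simp add: Suc_le_eq card_gt_0_iff)
  next
    case (Suc j)
    then consider (big) t where "t \<le> j * r" "15 * card V < 16 * card (T t)"
      | (grow) t where "t \<le> j * r" "(1 + \<mu>) ^ j \<le> real (card (T t))" "16 * card (T t) \<le> 15 * card V"
      by (meson Suc_leD not_le)
    then show ?case
    proof cases
      case big
      then have "t \<le> Suc j * r" by simp
      then show ?thesis using big(2) by blast
    next
      case grow
      have "(0::real) < (1 + \<mu>) ^ j" using mu0 by (intro zero_less_power) simp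
      then have "real (card (T t)) \<noteq> 0" using grow(2) by linarith
      then have "T t \<noteq> {}" by (metis card.empty of_nat_0)
      have tk: "t + k < (m + 1) * r" if "k < r" for k
      proof -
        have "j * r \<le> m * r" using Suc.prems by (intro mult_right_mono) auto
        then show ?thesis using that grow(1) unfolding add_mult_distrib mult_1 by linarith
      qed
      obtain k where k: "k \<le> r" "(1 + \<mu>) * real (card (T t)) \<le> real (card (T (t + k)))"
        using growth_round[where T = T and t = t, OF ext r2 M mu de T \<open>T t \<noteq> {}\<close> grow(3) loss[OF tk]]
        by blast
      have "(1 + \<mu>) ^ Suc j \<le> (1 + \<mu>) * real (card (T t))"
        using grow(2) mu0 by simp
      with k have "(1 + \<mu>) ^ Suc j \<le> real (card (T (t + k)))" by linarith
      moreover have "t + k \<le> Suc j * r" using k grow(1) by simp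
      ultimately show ?thesis by blast
    qed
  qed
  \<comment> \<open>Since \<open>ln (1 + \<mu>)\<close> is at least
    \<open>\<mu> - \<mu>\<^sup>2\<close>, hence at least \<open>\<mu> / 2\<close>, the bound
    \<open>2 * M / \<mu>\<close> on \<open>m\<close> gives
    \<open>(1 + \<mu>) ^ m \<ge> card V\<close>.\<close>
  have "\<mu> * \<mu> \<le> \<mu> * (1 / 2)" using mu0 mu1 by (intro mult_left_mono) auto
  then have "\<mu> / 2 \<le> ln (1 + \<mu>)"
    using ln_one_plus_pos_lower_bound[of \<mu>] mu0 mu1 unfolding power2_eq_square by linarith
  then have "real m * (\<mu> / 2) \<le> real m * ln (1 + \<mu>)" by (intro mult_left_mono) auto
  moreover have "M \<le> real m * (\<mu> / 2)" using m mu0 by (simp add: field_simps)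
  ultimately have "ln (real (card V)) \<le> ln ((1 + \<mu>) ^ m)"
    using M mu0 by (simp add: ln_realpow)
  moreover have V0: "card V > 0" using fin neV by (simp add: card_gt_0_iff)
  ultimately have "real (card V) \<le> (1 + \<mu>) ^ m" using mu0 by (subst (asm) ln_le_cancel_iff) auto
  \<comment> \<open>After \<open>m\<close> rounds both alternatives of \<open>step\<close> thus
    exceed 15/16.\<close>
  then have big: "15 * card V < 16 * card (T t)" if "(1 + \<mu>) ^ m \<le> real (card (T t))" for t
    using that V0 by linarith
  obtain t where t: "t \<le> m * r" "15 * card V < 16 * card (T t)"
    using step[of m] big by (meson order_refl)
  \<comment> \<open>A single step loses at most \<open>\<delta> * card V\<close> vertices, so fewer
    than \<open>r\<close> steps lose at most \<open>\<mu> * card V\<close>, a 1/512 part of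
    \<open>V\<close>.\<close>
  have decay: "real (card (T t)) - real k * \<delta> * real (card V) \<le> real (card (T (t + k)))" if "k \<le> r" for k
    using that
  proof (induction k)
    case (Suc k)
    let ?N = "nbr ((t + k) mod r) V (T (t + k))"
    have finN: "finite ?N" using fin by (rule finite_nbr)
    have "card (T (t + k)) \<le> card ?N" using finN subset_nbr[OF T] by (simp add: card_mono)
    moreover have "card ?N \<le> card (?N - T (Suc (t + k))) + card (T (Suc (t + k)))"
      using diff_card_le_card_Diff[OF finT, of ?N "Suc (t + k)"] by linarith
    moreover have "real (card (?N - T (Suc (t + k)))) \<le> \<delta> * real (card ?N)"
      using Suc.prems t(1) by (intro loss) simp
    moreover have "card ?N \<le> card V" using fin by (auto simp: nbr_def intro!: card_mono)
    then have "\<delta> * real (card ?N) \<le> \<delta> * real (card V)" using de0 by simp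
    ultimately show ?case using Suc by (simp add: algebra_simps)
  qed simp
  obtain k where k: "k < r" "(t + k) mod r = 0" using add_mod_surj[OF r] by blast
  have "real k * \<delta> * real (card V) \<le> real r * \<delta> * real (card V)"
    using k de0 by (intro mult_right_mono) auto
  also have "\<dots> = \<mu> * real (card V)" by (simp only: de0)
  also have "\<dots> \<le> (1 / 512) * real (card V)" using mu1 by (intro mult_right_mono) auto
  finally have "7 * real (card V) \<le> 8 * real (card (T (t + k)))"
    using decay[of k] k t(2) by simp
  moreover have "t + k < (m + 1) * r" using k t(1) by simp
  ultimately show ?thesis using k(2) by (intro exI[of _ "t + k"]) auto
qed

section \<open>Tight walks\<close>

text \<open>The sequence \<open>u\<close> lists hypergraph vertices. Writing them cyclically into
  the coordinates keeps the latest \<open>r\<close> of them as the current tuple, so tight paths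
  become walks in the line graph.\<close>

primrec walk_state :: "nat \<Rightarrow> (nat \<Rightarrow> 'a) \<Rightarrow> (nat \<Rightarrow> 'a) \<Rightarrow> nat \<Rightarrow> nat \<Rightarrow> 'a" where
  "walk_state r e u 0 = e"
| "walk_state r e u (Suc k) = (walk_state r e u k)(k mod r := u k)"

text \<open>The list \<open>ws\<close> omits the elements of the starting tuple \<open>e\<close>, so
  consecutive walks concatenate without overlap.\<close>

definition tight_walk :: "nat \<Rightarrow> (nat \<Rightarrow> 'a) set \<Rightarrow> (nat \<Rightarrow> 'a) \<Rightarrow> 'a list \<Rightarrow> (nat \<Rightarrow> 'a) \<Rightarrow> bool" where
  "tight_walk r V e ws f \<longleftrightarrow>
     (\<forall>k\<le>length ws. walk_state r e ((!) ws) k \<in> V) \<and> walk_state r e ((!) ws) (length ws) = f"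

lemma walk_state_cong:
  "(\<And>j. j < k \<Longrightarrow> u j = v j) \<Longrightarrow> walk_state r e u k = walk_state r e v k"
  by (induction k) auto

text \<open>Restarting after a multiple of \<open>r\<close> steps keeps the directions in
  phase.\<close>

lemma walk_state_add:
  assumes "r dvd n"
  shows "walk_state r e u (n + k) = walk_state r (walk_state r e u n) (\<lambda>j. u (n + j)) k"
proof (induction k)
  case (Suc k)
  have "(n + k) mod r = k mod r" using assms by (auto simp: dvd_def)
  with Suc show ?case by simp
qed simp

lemma walk_state_append:
  "k \<le> length ws \<Longrightarrow> walk_state r e ((!) (ws @ us)) k = walk_state r e ((!) ws) k"
  by (rule walk_state_cong) (simp add: nth_append)

lemma tight_walk_append:
  assumes ws: "tight_walk r V e ws f" and us: "tight_walk r V f us g" and dvd: "r dvd length ws"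
  shows "tight_walk r V e (ws @ us) g"
proof -
  have add: "walk_state r e ((!) (ws @ us)) (length ws + k) = walk_state r f ((!) us) k" for k
  proof -
    have "walk_state r e ((!) (ws @ us)) (length ws) = f"
      using ws by (simp add: walk_state_append tight_walk_def)
    then show ?thesis using walk_state_add[OF dvd, of e "(!) (ws @ us)" k] by simp
  qed
  have "walk_state r e ((!) (ws @ us)) k \<in> V" if "k \<le> length (ws @ us)" for k
  proof (cases "k \<le> length ws")
    case True
    then show ?thesis using ws by (simp add: walk_state_append tight_walk_def)
  next
    case False
    then obtain j where "k = length ws + j" by (metis le_add_diff_inverse nat_le_linear)
    then show ?thesis using us that by (simp add: add tight_walk_def)
  qed
  then show ?thesis using us by (simp add: tight_walk_def add)
qed

lemma tight_walk_snoc: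
  assumes ws: "tight_walk r V e ws x" and y: "y \<in> V" "key i y = key i x"
    and i: "i = length ws mod r"
  shows "tight_walk r V e (ws @ [y i]) y"
proof -
  have "y = x(i := y i)"
    using y(2) unfolding key_def by (metis fun_upd_triv fun_upd_upd)
  then have last: "walk_state r e ((!) (ws @ [y i])) (Suc (length ws)) = y"
    using ws i by (simp add: walk_state_append tight_walk_def)
  have "walk_state r e ((!) (ws @ [y i])) k \<in> V" if "k \<le> Suc (length ws)" for k
  proof (cases "k = Suc (length ws)")
    case True
    then show ?thesis using last y(1) by simp
  next
    case False
    then show ?thesis using ws that by (simp add: walk_state_append tight_walk_def)
  qed
  then show ?thesis using last by (simp add: tight_walk_def)
qed

text \<open>A coordinate is rewritten only every \<open>r\<close> steps, so an entry survives the
  \<open>r - 1\<close> steps after it was written.\<close>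

lemma walk_state_latest:
  "m < r \<Longrightarrow> walk_state r e u (Suc (n + m)) (n mod r) = u n"
proof (induction m)
  case (Suc m)
  have "(n + Suc m) mod r \<noteq> n mod r"
  proof
    assume "(n + Suc m) mod r = n mod r"
    then have "r dvd (n + Suc m) - n" by (rule mod_eq_dvd_iff_nat[THEN iffD1, rotated]) simp
    then show False using Suc.prems by (auto dest: dvd_imp_le)
  qed
  then show ?case using Suc by simp
qed simp

text \<open>After \<open>r\<close> steps nothing older survives: the tuple consists of the last
  \<open>r\<close> entries, a window of the tight path.\<close>

lemma walk_state_image:
  assumes "r > 0"
  shows "walk_state r e u (k + r) ` {..<r} = {u (k + j) | j. j < r}"
proof -
  have eq: "walk_state r e u (k + r) ((k + j) mod r) = u (k + j)" if "j < r" for j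
    using walk_state_latest[of "r - Suc j" r e u "k + j"] that by simp
  have "\<exists>j<r. i = (k + j) mod r" if "i < r" for i
    using add_mod_surj[OF that, of k] by metis
  then have "{..<r} = (\<lambda>j. (k + j) mod r) ` {..<r}" using assms by auto
  then have "walk_state r e u (k + r) ` {..<r} = walk_state r e u (k + r) ` (\<lambda>j. (k + j) mod r) ` {..<r}"
    by simp
  also have "\<dots> = (\<lambda>j. u (k + j)) ` {..<r}"
    unfolding image_image by (rule image_cong) (simp_all add: eq)
  finally show ?thesis by auto
qed

text \<open>Running twice through the closed walk turns every cyclic window into an ordinary one.\<close>

lemma closed_tight_walk:
  assumes r: "r > 0" and ws: "tight_walk r V e ws e" and dvd: "r dvd length ws"
    and dist: "distinct ws" and len: "r + 1 \<le> length ws"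
  shows "contains_tight_cycle r (hyperedges r V)"
proof -
  have ww: "tight_walk r V e (ws @ ws) e" using tight_walk_append[OF ws ws dvd] .
  have "{ws ! ((i + j) mod length ws) | j. j < r} \<in> hyperedges r V" if i: "i < length ws" for i
  proof -
    have nth: "(ws @ ws) ! (i + j) = ws ! ((i + j) mod length ws)" if "j < r" for j
      using that i len by (simp add: nth_append mod_if)
    have "{ws ! ((i + j) mod length ws) | j. j < r} = {(ws @ ws) ! (i + j) | j. j < r}"
      using nth by metis
    also have "\<dots> = walk_state r e ((!) (ws @ ws)) (i + r) ` {..<r}"
      using walk_state_image[OF r] by metis
    also have "\<dots> \<in> hyperedges r V"
      using ww i len by (auto simp: hyperedges_def tight_walk_def)
    finally show ?thesis .
  qed
  then show ?thesis using len dist by (auto simp: contains_tight_cycle_def)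
qed

section \<open>Reachability by tight paths avoiding a set\<close>

text \<open>The length is exactly \<open>t\<close> so that all these paths continue in the same
  direction \<open>t mod r\<close>.\<close>

definition reach :: "nat \<Rightarrow> (nat \<Rightarrow> 'a) set \<Rightarrow> (nat \<Rightarrow> 'a) \<Rightarrow> 'a set \<Rightarrow> nat \<Rightarrow> (nat \<Rightarrow> 'a) set" where
  "reach r V e F t =
     {f. \<exists>ws. length ws = t \<and> tight_walk r V e ws f \<and> distinct ws \<and> set ws \<inter> F = {}}"

lemma reach_subset: "reach r V e F t \<subseteq> V"
  by (auto simp: reach_def tight_walk_def)

lemma reach_0: "e \<in> V \<Longrightarrow> reach r V e F 0 = {e}"
  by (auto simp: reach_def tight_walk_def)

text \<open>A path to \<open>x\<close> extends to \<open>y\<close> in its block unless the new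
  element \<open>y (t mod r)\<close> is forbidden or already used. That element determines
  \<open>y\<close> within the block.\<close>

lemma card_block_diff_reach:
  assumes fin: "finite F" and x: "x \<in> reach r V e F t"
  shows "card ({y \<in> V. key (t mod r) y = key (t mod r) x} - reach r V e F (Suc t)) \<le> card F + t"
proof -
  let ?i = "t mod r"
  let ?M = "{y \<in> V. key ?i y = key ?i x} - reach r V e F (Suc t)"
  obtain ws where ws: "length ws = t" "tight_walk r V e ws x" "distinct ws" "set ws \<inter> F = {}"
    using x by (auto simp: reach_def)
  have "inj_on (\<lambda>y. y ?i) ?M"
  proof (rule inj_onI)
    fix y z assume "y \<in> ?M" "z \<in> ?M" and eq: "y ?i = z ?i"
    then have "key ?i y = key ?i z" by simp
    then show "y = z" using eq unfolding key_def by (metis fun_upd_triv fun_upd_upd)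
  qed
  moreover have "(\<lambda>y. y ?i) ` ?M \<subseteq> F \<union> set ws"
  proof
    fix a assume "a \<in> (\<lambda>y. y ?i) ` ?M"
    then obtain y where y: "y \<in> V" "key ?i y = key ?i x" "y \<notin> reach r V e F (Suc t)" "a = y ?i"
      by auto
    have "tight_walk r V e (ws @ [a]) y"
      using tight_walk_snoc[OF ws(2) y(1,2)] ws(1) y(4) by simp
    then have "\<not> (distinct (ws @ [a]) \<and> set (ws @ [a]) \<inter> F = {})"
      using y(3) ws(1) unfolding reach_def mem_Collect_eq by (metis length_append_singleton)
    then show "a \<in> F \<union> set ws" using ws by auto
  qed
  ultimately have "card ?M \<le> card (F \<union> set ws)" using fin by (intro card_inj_on_le) auto
  also have "\<dots> \<le> card F + card (set ws)" by (rule card_Un_le)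
  also have "\<dots> \<le> card F + t" using ws(1) card_length[of ws] by simp
  finally show ?thesis .
qed

text \<open>The paths are chosen one after another, each of them avoiding the elements that already lie
  on \<open>\<theta>\<close> earlier paths; double counting shows that there are few such elements.\<close>

lemma spread_choice:
  fixes V :: "'b set" and path :: "'b \<Rightarrow> 'a list \<Rightarrow> bool"
  assumes fin: "finite V" and \<theta>: "\<theta> > 0" and b: "card V * L \<le> b * \<theta>"
    and len: "\<And>f ws. path f ws \<Longrightarrow> length ws \<le> L"
    and many: "\<And>F. finite F \<Longrightarrow> card F \<le> b \<Longrightarrow>
      7 * card V \<le> 8 * card {f \<in> V. \<exists>ws. path f ws \<and> set ws \<inter> F = {}}"
  shows "\<exists>S P. S \<subseteq> V \<and> 7 * card V \<le> 8 * card S \<and> (\<forall>f\<in>S. path f (P f)) \<and>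
    (\<forall>a. card {f \<in> S. a \<in> set (P f)} \<le> \<theta>)"
proof -
  define Q where "Q S P \<longleftrightarrow> S \<subseteq> V \<and> (\<forall>f\<in>S. path f (P f)) \<and> (\<forall>a. card {f \<in> S. a \<in> set (P f)} \<le> \<theta>)"
    for S and P :: "'b \<Rightarrow> 'a list"
  \<comment> \<open>The bound on \<open>m\<close> lets the induction run up to 7/8 of
    \<open>card V\<close>, rounded up.\<close>
  have "\<exists>S P. Q S P \<and> card S = m" if "8 * m \<le> 7 * card V + 7" for m
    using that
  proof (induction m)
    case 0
    then show ?case by (intro exI[of _ "{}"]) (simp add: Q_def)
  next
    case (Suc m)
    then obtain S P where S: "Q S P" "card S = m" by auto
    have finS: "finite S" using S fin finite_subset by (auto simp: Q_def)
    define F where "F = {a. card {f \<in> S. a \<in> set (P f)} \<ge> \<theta>}"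
    have "F \<subseteq> (\<Union>f\<in>S. set (P f))"
    proof
      fix a assume "a \<in> F"
      then have "card {f \<in> S. a \<in> set (P f)} \<noteq> 0" using \<theta> by (simp add: F_def)
      then have "{f \<in> S. a \<in> set (P f)} \<noteq> {}" by (metis card.empty)
      then show "a \<in> (\<Union>f\<in>S. set (P f))" by blast
    qed
    then have finF: "finite F" using finS finite_subset by blast
    have "card F * \<theta> = (\<Sum>a\<in>F. \<theta>)" by simp
    also have "\<dots> \<le> (\<Sum>a\<in>F. card {f \<in> S. a \<in> set (P f)})"
      by (rule sum_mono) (simp add: F_def)
    also have "\<dots> = (\<Sum>f\<in>S. card {a \<in> F. a \<in> set (P f)})"
      using finF finS by (intro sum_multicount_gen) auto
    also have "\<dots> \<le> (\<Sum>f\<in>S. L)"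
    proof (rule sum_mono)
      fix f assume "f \<in> S"
      then have "length (P f) \<le> L" using S(1) len by (auto simp: Q_def)
      have "card {a \<in> F. a \<in> set (P f)} \<le> card (set (P f))" by (intro card_mono) auto
      also have "\<dots> \<le> L" using \<open>length (P f) \<le> L\<close> card_length[of "P f"] by linarith
      finally show "card {a \<in> F. a \<in> set (P f)} \<le> L" .
    qed
    also have "\<dots> \<le> card V * L"
      using S(1) fin by (simp add: Q_def card_mono)
    also note b
    finally have "card F \<le> b" using \<theta> by simp
    define R where "R = {f \<in> V. \<exists>ws. path f ws \<and> set ws \<inter> F = {}}"
    have "7 * card V \<le> 8 * card R"
      using many[OF finF \<open>card F \<le> b\<close>] by (simp only: R_def)
    then have "card S < card R" using Suc.prems S(2) by simp
    then have "\<not> R \<subseteq> S" using finS card_mono leD by blast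
    then obtain f ws where f: "f \<in> V" "f \<notin> S" "path f ws" "set ws \<inter> F = {}"
      by (auto simp: R_def)
    have "card {g \<in> insert f S. a \<in> set ((P(f := ws)) g)} \<le> \<theta>" for a
    proof (cases "a \<in> set ws")
      case True
      \<comment> \<open>The new path avoids \<open>F\<close>, so its elements were below the limit
        and one more path is allowed.\<close>
      then have "card {g \<in> S. a \<in> set (P g)} < \<theta>" using f(4) by (auto simp: F_def)
      moreover have "{g \<in> insert f S. a \<in> set ((P(f := ws)) g)} = insert f {g \<in> S. a \<in> set (P g)}"
        using True f(2) by auto
      ultimately show ?thesis using finS f(2) by simp
    next
      case False
      then have "{g \<in> insert f S. a \<in> set ((P(f := ws)) g)} = {g \<in> S. a \<in> set (P g)}"
        using f(2) by auto
      then show ?thesis using S(1) by (simp add: Q_def)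
    qed
    then have "Q (insert f S) (P(f := ws))"
      using S(1) f by (auto simp: Q_def)
    moreover have "card (insert f S) = Suc m" using finS f(2) S(2) by simp
    ultimately show ?case by blast
  qed
  from this[of "(7 * card V + 7) div 8"] obtain S P where S: "Q S P" "card S = (7 * card V + 7) div 8"
    by auto
  have "7 * card V \<le> 8 * card S" unfolding S(2) by linarith
  with S(1) show ?thesis unfolding Q_def by blast
qed

text \<open>A union bound over all ordered triples, repetitions allowed: each rotation of
  \<open>R\<close> holds for at most a quarter of them.\<close>

lemma exists_cyclic_triple:
  assumes fin: "finite V" and ne: "V \<noteq> {}"
    and R: "\<And>a b. a \<in> V \<Longrightarrow> b \<in> V \<Longrightarrow> 4 * card {c \<in> V. R a b c} \<le> card V"
  shows "\<exists>a\<in>V. \<exists>b\<in>V. \<exists>c\<in>V. \<not> R a b c \<and> \<not> R b c a \<and> \<not> R c a b"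
proof (rule ccontr)
  assume "\<not> ?thesis"
  then have one: "1 \<le> (of_bool (R a b c) + of_bool (R b c a) + of_bool (R c a b) :: nat)"
    if "a \<in> V" "b \<in> V" "c \<in> V" for a b c
    using that by auto
  let ?n = "card V"
  define s :: nat where "s = (\<Sum>a\<in>V. \<Sum>b\<in>V. \<Sum>c\<in>V. of_bool (R a b c))"
  have rot: "(\<Sum>a\<in>V. \<Sum>b\<in>V. \<Sum>c\<in>V. g b c a) = (\<Sum>a\<in>V. \<Sum>b\<in>V. \<Sum>c\<in>V. g a b c :: nat)" for g
  proof -
    have "(\<Sum>a\<in>V. \<Sum>b\<in>V. \<Sum>c\<in>V. g b c a) = (\<Sum>b\<in>V. \<Sum>a\<in>V. \<Sum>c\<in>V. g b c a)" by (rule sum.swap)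
    also have "\<dots> = (\<Sum>b\<in>V. \<Sum>c\<in>V. \<Sum>a\<in>V. g b c a)" by (rule sum.cong[OF refl], rule sum.swap)
    finally show ?thesis .
  qed
  have "?n * (?n * ?n) = (\<Sum>a\<in>V. \<Sum>b\<in>V. \<Sum>c\<in>V. 1)" by simp
  also have "\<dots> \<le> (\<Sum>a\<in>V. \<Sum>b\<in>V. \<Sum>c\<in>V. of_bool (R a b c) + of_bool (R b c a) + of_bool (R c a b))"
    using one by (intro sum_mono) blast
  also have "\<dots> = s + (\<Sum>a\<in>V. \<Sum>b\<in>V. \<Sum>c\<in>V. of_bool (R b c a)) + (\<Sum>a\<in>V. \<Sum>b\<in>V. \<Sum>c\<in>V. of_bool (R c a b))"
    by (simp only: sum.distrib s_def)
  also have "\<dots> = 3 * s"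
    using rot[of "\<lambda>a b c. of_bool (R a b c)"] rot[of "\<lambda>a b c. of_bool (R b c a)"]
    by (simp only: s_def)
  finally have "?n * (?n * ?n) \<le> 3 * s" .
  moreover have "4 * s \<le> ?n * (?n * ?n)"
  proof -
    have "4 * s = (\<Sum>a\<in>V. \<Sum>b\<in>V. 4 * card {c \<in> V. R a b c})"
      using fin by (simp add: s_def sum_distrib_left Int_def flip: card_eq_sum)
    also have "\<dots> \<le> (\<Sum>a\<in>V. \<Sum>b\<in>V. ?n)" using R by (intro sum_mono) blast
    finally show ?thesis by simp
  qed
  moreover have "?n * (?n * ?n) > 0" using fin ne by (simp add: card_gt_0_iff)
  ultimately show False by linarith
qed

section \<open>Tight cycles in dense graphs\<close>

text \<open>By \<open>dense\<close>, the at most \<open>b + L\<close> elements blocking an extension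
  are at most a \<open>\<delta>\<close> part of the guaranteed block size
  \<open>card V / key_count r V\<close>, so the sets \<open>reach r V e F t\<close> satisfy the loss
  condition of \<open>growth\<close>.\<close>

lemma reach_grows:
  assumes ext: "extremal r M V" and r: "r \<ge> 2" and M: "M \<ge> 1" "ln (real (card V)) \<le> M"
    and mu: "\<mu> = 1 / (512 * real r * M)" and de: "\<delta> = \<mu> / real r"
    and m: "2 * M / \<mu> \<le> real m" and L: "L = (m + 1) * r"
    and dense: "real (b + L) * real (key_count r V) \<le> \<delta> * real (card V)"
    and V2: "card V \<ge> 2" and e: "e \<in> V" and F: "finite F" "card F \<le> b"
  shows "7 * card V \<le> 8 * card {f \<in> V. \<exists>ws. (tight_walk r V e ws f \<and> distinct ws \<and>
           r dvd length ws \<and> ws \<noteq> [] \<and> length ws \<le> L) \<and> set ws \<inter> F = {}}"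
proof -
  have fin: "finite V" and ne: "V \<noteq> {}" using ext by (auto simp: extremal_def)
  define P where "P = real (key_count r V)"
  have P: "P > 0" using key_count_pos[OF fin ne, of r] r by (simp add: P_def)
  have \<delta>: "\<delta> \<ge> 0" using M by (simp add: mu de)
  have M0: "M > 0" using M by simp
  let ?T = "reach r V e F"
  have "real (card (nbr (k mod r) V (?T k) - ?T (Suc k))) \<le> \<delta> * real (card (nbr (k mod r) V (?T k)))"
    if k: "k < (m + 1) * r" for k
  proof (rule card_nbr_diff_le[OF fin reach_subset \<delta>, where D = "real (card V) / P"])
    fix x assume "x \<in> V"
    moreover have "k mod r < r" using r by simp
    ultimately have "real (card V) \<le> P * real (card {y \<in> V. key (k mod r) y = key (k mod r) x})"
      unfolding P_def by (rule extremal_block_size[OF ext M0])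
    then show "real (card V) / P \<le> real (card {y \<in> V. key (k mod r) y = key (k mod r) x})"
      using P by (simp add: field_simps)
  next
    fix x assume "x \<in> ?T k"
    then have "card ({y \<in> V. key (k mod r) y = key (k mod r) x} - ?T (Suc k)) \<le> card F + k"
      by (rule card_block_diff_reach[OF F(1)])
    also have "\<dots> \<le> b + L" using F(2) k L by simp
    finally have "real (card ({y \<in> V. key (k mod r) y = key (k mod r) x} - ?T (Suc k))) \<le> real (b + L)"
      by (simp only: of_nat_le_iff)
    also have "\<dots> \<le> \<delta> * (real (card V) / P)" using dense P by (simp add: P_def field_simps)
    finally show "real (card ({y \<in> V. key (k mod r) y = key (k mod r) x} - ?T (Suc k)))
      \<le> \<delta> * (real (card V) / P)" .
  qed
  note loss = this
  have "?T 0 \<noteq> {}" using reach_0[OF e] by simp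
  then obtain t where t: "t < L" "r dvd t" "7 * card V \<le> 8 * card (?T t)"
    using growth[where T = ?T, OF ext r M mu de m reach_subset _ loss] L by blast
  \<comment> \<open>At time 0 only \<open>e\<close> is reached, which is less than 7/8 of two or
    more vertices; so the paths are nonempty.\<close>
  have "t \<noteq> 0"
  proof
    assume "t = 0"
    then have "7 * card V \<le> 8" using t(3) reach_0[OF e] by simp
    then show False using V2 by simp
  qed
  then have "?T t \<subseteq> {f \<in> V. \<exists>ws. (tight_walk r V e ws f \<and> distinct ws \<and>
           r dvd length ws \<and> ws \<noteq> [] \<and> length ws \<le> L) \<and> set ws \<inter> F = {}}"
    using t reach_subset[of r V e F t] by (fastforce simp: reach_def)
  then have "card (?T t) \<le> card {f \<in> V. \<exists>ws. (tight_walk r V e ws f \<and> distinct ws \<and>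
           r dvd length ws \<and> ws \<noteq> [] \<and> length ws \<le> L) \<and> set ws \<inter> F = {}}"
    using fin by (intro card_mono) auto
  then show ?thesis using t(3) by linarith
qed

lemma tight_cycle_if_spread_paths:
  fixes S :: "(nat \<Rightarrow> 'a) \<Rightarrow> (nat \<Rightarrow> 'a) set" and P :: "(nat \<Rightarrow> 'a) \<Rightarrow> (nat \<Rightarrow> 'a) \<Rightarrow> 'a list"
  assumes fin: "finite V" and ne: "V \<noteq> {}" and r: "r \<ge> 2"
    and S: "\<And>e. e \<in> V \<Longrightarrow> S e \<subseteq> V" "\<And>e. e \<in> V \<Longrightarrow> 7 * card V \<le> 8 * card (S e)"
    and P: "\<And>e f. e \<in> V \<Longrightarrow> f \<in> S e \<Longrightarrow> tight_walk r V e (P e f) f \<and> distinct (P e f) \<and>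
           r dvd length (P e f) \<and> P e f \<noteq> [] \<and> length (P e f) \<le> L"
    and load: "\<And>e a. e \<in> V \<Longrightarrow> card {f \<in> S e. a \<in> set (P e f)} \<le> \<theta>"
    and \<theta>: "8 * (L * \<theta>) \<le> card V"
  shows "contains_tight_cycle r (hyperedges r V)"
proof -
  \<comment> \<open>For fixed \<open>e\<close> and \<open>f\<close>, at most 1/8 of all
    \<open>g\<close> lie outside \<open>S f\<close>, and at most \<open>L * \<theta>\<close>, again
    1/8 of \<open>V\<close>, have a path from \<open>f\<close> meeting the one from \<open>e\<close>
    to \<open>f\<close>. If all three rotations are good, all three paths exist.\<close>
  define bad where "bad e f g \<longleftrightarrow> g \<notin> S f \<or> f \<in> S e \<and> set (P e f) \<inter> set (P f g) \<noteq> {}" for e f g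
  have "4 * card {g \<in> V. bad e f g} \<le> card V" if ef: "e \<in> V" "f \<in> V" for e f
  proof -
    define A where "A = (if f \<in> S e then set (P e f) else {})"
    have A: "finite A" "card A \<le> L"
      using P[OF ef(1), of f] card_length[of "P e f"] by (auto simp: A_def intro: order_trans)
    have finS: "finite (S f)" using S(1)[OF ef(2)] fin finite_subset by blast
    have "{g \<in> V. bad e f g} \<subseteq> (V - S f) \<union> (\<Union>a\<in>A. {g \<in> S f. a \<in> set (P f g)})"
      by (auto simp: bad_def A_def)
    then have "card {g \<in> V. bad e f g} \<le> card ((V - S f) \<union> (\<Union>a\<in>A. {g \<in> S f. a \<in> set (P f g)}))"
      using fin finS A by (intro card_mono) auto
    also have "\<dots> \<le> card (V - S f) + card (\<Union>a\<in>A. {g \<in> S f. a \<in> set (P f g)})"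
      by (rule card_Un_le)
    also have "card (\<Union>a\<in>A. {g \<in> S f. a \<in> set (P f g)}) \<le> (\<Sum>a\<in>A. card {g \<in> S f. a \<in> set (P f g)})"
      using A(1) by (rule card_UN_le)
    also have "\<dots> \<le> (\<Sum>a\<in>A. \<theta>)" by (intro sum_mono load ef)
    also have "\<dots> \<le> L * \<theta>" using A(2) by simp
    finally have "card {g \<in> V. bad e f g} \<le> card (V - S f) + L * \<theta>" by simp
    moreover have "card (V - S f) = card V - card (S f)"
      using finS S(1)[OF ef(2)] by (rule card_Diff_subset)
    ultimately show ?thesis using S(2)[OF ef(2)] \<theta> by linarith
  qed
  then obtain e f g where V: "e \<in> V" "f \<in> V" "g \<in> V"
    and nb: "\<not> bad e f g" "\<not> bad f g e" "\<not> bad g e f"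
    using exists_cyclic_triple[OF fin ne, of bad] by blast
  have mem: "g \<in> S f" "e \<in> S g" "f \<in> S e" using nb by (auto simp: bad_def)
  note Pe = P[OF V(1) mem(3)] and Pf = P[OF V(2) mem(1)] and Pg = P[OF V(3) mem(2)]
  let ?ws = "P e f @ P f g @ P g e"
  have walk: "tight_walk r V e ?ws e"
    using Pe Pf Pg by (intro tight_walk_append) auto
  have dist: "distinct ?ws" using Pe Pf Pg nb mem by (auto simp: bad_def)
  have dvd: "r dvd length ?ws" using Pe Pf Pg by (simp add: dvd_add)
  \<comment> \<open>Nonempty paths of length divisible by \<open>r\<close> have length at least
    \<open>r\<close>, so two of them already exceed \<open>r\<close>.\<close>
  have "r \<le> length (P e f)" "r \<le> length (P f g)" using Pe Pf by (auto intro: dvd_imp_le)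
  then have "r + 1 \<le> length ?ws" using r by simp
  then show ?thesis using closed_tight_walk[OF _ walk dvd dist] r by simp
qed

lemma dense_extremal_tight_cycle:
  fixes V :: "(nat \<Rightarrow> 'a) set"
  assumes ext: "extremal r M V" and r: "r \<ge> 2" and M: "M \<ge> 1" "ln (real (card V)) \<le> M"
    and mu: "\<mu> = 1 / (512 * real r * M)" and de: "\<delta> = \<mu> / real r"
    and m: "2 * M / \<mu> \<le> real m" and L: "L = (m + 1) * r"
    and dense: "real (16 * L\<^sup>2 + L) * real (key_count r V) \<le> \<delta> * real (card V)"
  shows "contains_tight_cycle r (hyperedges r V)"
proof -
  have fin: "finite V" and ne: "V \<noteq> {}" using ext by (auto simp: extremal_def)
  have L2: "L \<ge> 2" using r by (simp add: L)
  have "1 * 1 \<le> 512 * real r * M" using r M by (intro mult_mono) auto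
  then have "\<mu> \<le> 1" using r M by (simp add: mu)
  then have "\<delta> \<le> 1" using r by (simp add: de divide_le_eq)
  have "8 * L \<le> 16 * L\<^sup>2 + L" using L2 by (simp add: power2_eq_square)
  then have "real (8 * L) \<le> real (16 * L\<^sup>2 + L)" by (simp only: of_nat_le_iff)
  also have "\<dots> = real (16 * L\<^sup>2 + L) * 1" by simp
  also have "\<dots> \<le> real (16 * L\<^sup>2 + L) * real (key_count r V)"
    using key_count_pos[OF fin ne, of r] r by (intro mult_left_mono) auto
  also note dense
  also have "\<delta> * real (card V) \<le> 1 * real (card V)"
    using \<open>\<delta> \<le> 1\<close> by (intro mult_right_mono) auto
  finally have n8: "8 * L \<le> card V" by simp
  \<comment> \<open>The largest limit with \<open>8 * (L * \<theta>) \<le> card V\<close>. It is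
    positive, so rounding down costs at most a factor 2; this explains the budget
    \<open>16 * L\<^sup>2\<close> of forbidden elements.\<close>
  define \<theta> where "\<theta> = card V div (8 * L)"
  have \<theta>0: "\<theta> > 0" using n8 L2 by (simp add: \<theta>_def div_greater_zero_iff)
  have \<theta>: "8 * (L * \<theta>) \<le> card V"
    using times_div_less_eq_dividend[of "8 * L" "card V"] by (simp add: \<theta>_def mult.assoc)
  have "card V < 8 * L * (\<theta> + 1)"
    unfolding \<theta>_def using L2 dividend_less_times_div[of "8 * L" "card V"] by simp
  also have "\<dots> \<le> 8 * L * (2 * \<theta>)" using \<theta>0 by (intro mult_left_mono) auto
  finally have "card V * L \<le> (16 * L * \<theta>) * L" by simp
  then have b: "card V * L \<le> (16 * L\<^sup>2) * \<theta>" by (simp add: power2_eq_square mult_ac)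
  let ?path = "\<lambda>e f ws. tight_walk r V e ws f \<and> distinct ws \<and> r dvd length ws \<and> ws \<noteq> [] \<and> length ws \<le> L"
  have V2: "card V \<ge> 2" using n8 L2 by simp
  define spread where "spread e S P \<longleftrightarrow> S \<subseteq> V \<and> 7 * card V \<le> 8 * card S \<and> (\<forall>f\<in>S. ?path e f (P f)) \<and>
    (\<forall>a. card {f \<in> S. a \<in> set (P f)} \<le> \<theta>)" for e S and P :: "(nat \<Rightarrow> 'a) \<Rightarrow> 'a list"
  have "\<exists>S P. spread e S P" if e: "e \<in> V" for e
  proof -
    have many: "7 * card V \<le> 8 * card {f \<in> V. \<exists>ws. ?path e f ws \<and> set ws \<inter> F = {}}"
      if "finite F" "card F \<le> 16 * L\<^sup>2" for F
      using reach_grows[OF ext r M mu de m L dense V2 e that] .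
    have len: "length ws \<le> L" if "?path e f ws" for f ws using that by simp
    show ?thesis
      unfolding spread_def by (rule spread_choice[where path = "?path e", OF fin \<theta>0 b len many])
  qed
  then obtain S P where "\<And>e. e \<in> V \<Longrightarrow> spread e (S e) (P e)" by metis
  then show ?thesis
    unfolding spread_def by (intro tight_cycle_if_spread_paths[OF fin ne r _ _ _ _ \<theta>, of S P]) simp_all
qed

section \<open>From the density threshold to the exponential bound\<close>

lemma hyperedges_mono: "W \<subseteq> V \<Longrightarrow> hyperedges r W \<subseteq> hyperedges r V"
  by (auto simp: hyperedges_def)

lemma contains_tight_cycle_mono:
  "contains_tight_cycle r H \<Longrightarrow> H \<subseteq> H' \<Longrightarrow> contains_tight_cycle r H'"
  unfolding contains_tight_cycle_def by blast

text \<open>The 2 comes from passing to an extremal subset, 17 from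
  \<open>16 * L\<^sup>2 + L \<le> 17 * L\<^sup>2\<close>, 512 from \<open>1 / \<delta>\<close>, and
  1026 from the bound on \<open>L\<close>.\<close>

definition cycle_const :: real where
  "cycle_const = 2 * (17 * 512 * 1026\<^sup>2)"

text \<open>An extremal subset \<open>W\<close> inherits the absence of tight cycles, so it violates
  the density condition of \<open>dense_extremal_tight_cycle\<close>; with \<open>L\<close> of order
  \<open>r\<^sup>2 * M\<^sup>2\<close> this bounds its density, and that of \<open>V\<close> up to a
  factor 2.\<close>

lemma card_le_if_no_tight_cycle:
  fixes V :: "(nat \<Rightarrow> 'a) set"
  assumes fin: "finite V" and ne: "V \<noteq> {}" and r: "r \<ge> 2"
    and nc: "\<not> contains_tight_cycle r (hyperedges r V)"
    and M: "M = 1 + ln (real (card V))"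
  shows "real (card V) \<le> cycle_const * real r ^ 6 * M ^ 5 * real (key_count r V)"
proof -
  have V1: "card V \<ge> 1" using fin ne by (simp add: Suc_le_eq card_gt_0_iff)
  then have M1: "M \<ge> 1" by (simp add: M)
  have r0: "r > 0" and r1: "real r \<ge> 1" using r by auto
  obtain W where W: "W \<subseteq> V" "extremal r M W"
    "real (card V) * real (key_count r W) \<le> 2 * real (card W) * real (key_count r V)"
    using extremal_subset[OF fin ne r0, of M] M1 M by auto
  have finW: "finite W" and neW: "W \<noteq> {}" using W(2) by (auto simp: extremal_def)
  have W1: "card W \<ge> 1" using finW neW by (simp add: Suc_le_eq card_gt_0_iff)
  have "card W \<le> card V" using W(1) fin by (simp add: card_mono)
  then have lnW: "ln (real (card W)) \<le> M" using W1 by (simp add: M add_increasing)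
  define \<mu> where "\<mu> = 1 / (512 * real r * M)"
  define \<delta> where "\<delta> = \<mu> / real r"
  define m where "m = nat \<lceil>2 * M / \<mu>\<rceil>"
  define L where "L = (m + 1) * r"
  have mu_inv: "2 * M / \<mu> = 1024 * real r * M\<^sup>2"
    using M1 r0 by (simp add: \<mu>_def power2_eq_square)
  have m: "2 * M / \<mu> \<le> real m" unfolding m_def by linarith
  have "2 * M / \<mu> \<ge> 0" using mu_inv by simp
  then have m_le: "real m \<le> 1024 * real r * M\<^sup>2 + 1"
    unfolding m_def mu_inv by linarith
  have "1 * 1 \<le> real r * M\<^sup>2" using r1 M1 by (intro mult_mono) (auto simp: one_le_power)
  then have "real m + 1 \<le> 1026 * (real r * M\<^sup>2)" using m_le by linarith
  then have "real L \<le> 1026 * (real r * M\<^sup>2) * real r"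
    unfolding L_def of_nat_mult of_nat_add of_nat_1 by (intro mult_right_mono) auto
  then have L_le: "real L \<le> 1026 * real r ^ 2 * M ^ 2" by (simp add: power2_eq_square mult_ac)
  have "\<not> contains_tight_cycle r (hyperedges r W)"
    using nc contains_tight_cycle_mono hyperedges_mono[OF W(1)] by blast
  then have sparse: "\<delta> * real (card W) < real (16 * L\<^sup>2 + L) * real (key_count r W)"
    using dense_extremal_tight_cycle[OF W(2) r M1 lnW \<mu>_def \<delta>_def m L_def] by linarith
  have "L \<ge> 1" using r0 by (simp add: L_def)
  then have "16 * L\<^sup>2 + L \<le> 17 * L\<^sup>2" by (simp add: power2_eq_square)
  then have "real (16 * L\<^sup>2 + L) \<le> real (17 * L\<^sup>2)" by (simp only: of_nat_le_iff)
  also have "\<dots> = 17 * (real L)\<^sup>2" by simp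
  also have "\<dots> \<le> 17 * (1026 * real r ^ 2 * M ^ 2)\<^sup>2"
    using L_le by (intro mult_left_mono power_mono) auto
  finally have L17: "real (16 * L\<^sup>2 + L) \<le> 17 * (1026 * real r ^ 2 * M ^ 2)\<^sup>2" .
  let ?c = "512 * (real r)\<^sup>2 * M"
  have c: "?c > 0" "?c * \<delta> = 1" using M1 r0 by (simp_all add: \<delta>_def \<mu>_def power2_eq_square)
  have "real (card W) = (?c * \<delta>) * real (card W)" by (simp only: c(2) mult_1)
  also have "\<dots> = ?c * (\<delta> * real (card W))" by (rule mult.assoc)
  also have "\<dots> \<le> ?c * (real (16 * L\<^sup>2 + L) * real (key_count r W))"
    using sparse c(1) by (intro mult_left_mono) auto
  also have "\<dots> \<le> ?c * (17 * (1026 * real r ^ 2 * M ^ 2)\<^sup>2 * real (key_count r W))"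
    using L17 c(1) by (intro mult_left_mono mult_right_mono) auto
  finally have "2 * real (card W) \<le> cycle_const * real r ^ 6 * M ^ 5 * real (key_count r W)"
    by (simp add: cycle_const_def power_mult_distrib power_numeral_reduce mult_ac)
  then have "2 * real (card W) * real (key_count r V)
      \<le> cycle_const * real r ^ 6 * M ^ 5 * real (key_count r W) * real (key_count r V)"
    by (intro mult_right_mono) auto
  with W(3) have "real (card V) * real (key_count r W)
      \<le> (cycle_const * real r ^ 6 * M ^ 5 * real (key_count r V)) * real (key_count r W)"
    by (simp add: mult_ac)
  moreover have "real (key_count r W) > 0" using key_count_pos[OF finW neW r0] r0 by simp
  ultimately show ?thesis by simp
qed

text \<open>With \<open>s = sqrt x\<close>, \<open>1 + x\<close> is at most
  \<open>(1 + s)\<^sup>2\<close>, hence at most \<open>exp (2 * s)\<close>. Since \<open>s\<close>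
  is bounded below, \<open>C\<close> can be absorbed into the exponent as well.\<close>

lemma polylog_le_exp_sqrt:
  fixes C x :: real
  assumes C: "C \<ge> 1" and x: "x \<ge> ln 2"
  shows "C * (1 + x) ^ 5 \<le> exp ((10 + ln C / sqrt (ln 2)) * sqrt x)"
proof -
  define s where "s = sqrt x"
  have x0: "x \<ge> 0" using x by (smt (verit) ln_ge_zero)
  have s: "s \<ge> 0" "x = s\<^sup>2" "s \<ge> sqrt (ln 2)" using x x0 by (auto simp: s_def)
  have "1 + x \<le> (1 + s)\<^sup>2" using s by (simp add: power2_eq_square algebra_simps)
  also have "\<dots> \<le> (exp s)\<^sup>2" using s by (intro power_mono exp_ge_add_one_self) auto
  finally have "(1 + x) ^ 5 \<le> ((exp s)\<^sup>2) ^ 5" using x0 by (intro power_mono) auto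
  also have "\<dots> = exp (10 * s)" by (simp flip: power_mult exp_of_nat_mult)
  finally have 1: "(1 + x) ^ 5 \<le> exp (10 * s)" .
  have "ln C * 1 \<le> ln C * (s / sqrt (ln 2))" using s C by (intro mult_left_mono) auto
  then have "exp (ln C) \<le> exp (ln C / sqrt (ln 2) * s)" by (subst exp_le_cancel_iff) simp
  then have "C \<le> exp (ln C / sqrt (ln 2) * s)" using C by simp
  with 1 have "C * (1 + x) ^ 5 \<le> exp (ln C / sqrt (ln 2) * s) * exp (10 * s)"
    using C x0 by (intro mult_mono) auto
  also have "\<dots> = exp ((10 + ln C / sqrt (ln 2)) * s)"
    by (simp add: algebra_simps flip: exp_add)
  finally show ?thesis by (simp add: s_def)
qed

theorem theorem2p1:
  fixes r :: nat
  assumes "r \<ge> 2"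
  shows "\<exists>c::real. c > 0 \<and>
    (\<forall>(A :: nat \<Rightarrow> 'a set) V E n.
       r_line_graph r A V E \<and> card V = n \<and> \<not> contains_tight_cycle r (hyperedges r V) \<longrightarrow>
       dens r V \<le> exp (c * sqrt (ln (real n))))"
proof -
  \<comment> \<open>One more power of \<open>r\<close> than in the bound on \<open>card V\<close>,
    from the factor \<open>r\<close> in the density.\<close>
  define C where "C = cycle_const * real r ^ 7"
  define c where "c = 10 + ln C / sqrt (ln 2)"
  have "1 * 1 \<le> C" unfolding C_def using assms
    by (intro mult_mono one_le_power) (auto simp: cycle_const_def)
  then have C: "C \<ge> 1" by simp
  then have "c > 0" by (simp add: c_def add_pos_nonneg)
  moreover have "dens r V \<le> exp (c * sqrt (ln (real (card V))))"
    if G: "r_line_graph r A V E" and nc: "\<not> contains_tight_cycle r (hyperedges r V)"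
    for A :: "nat \<Rightarrow> 'a set" and V E
  proof (cases "V = {}")
    case True
    \<comment> \<open>Without vertices the density is 0 / 0, which is 0.\<close>
    then show ?thesis by (simp add: dens_def)
  next
    case False
    have "V \<subseteq> PiE {..<r} A" "\<And>i. i < r \<Longrightarrow> finite (A i)"
      using G by (auto simp: r_line_graph_def)
    then have fin: "finite V" and "V \<subseteq> extensional {..<r}"
      using finite_subset[OF _ finite_PiE[of "{..<r}" A]] by (auto simp: PiE_def)
    then have dens: "dens r V = real r * real (card V) / real (key_count r V)"
      by (simp add: dens_def num_blocks_eq_key_count)
    have P: "real (key_count r V) \<ge> real r" "real r > 0"
      using key_count_pos[OF fin False, of r] assms by auto
    have V1: "card V \<ge> 1" using fin False by (simp add: Suc_le_eq card_gt_0_iff)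
    show ?thesis
    proof (cases "card V = 1")
      case True
      \<comment> \<open>For a single vertex the logarithm vanishes and the bound is 1; there are at
        least \<open>r\<close> blocks, so the density is at most 1.\<close>
      then show ?thesis using P by (simp add: dens)
    next
      case False
      let ?x = "ln (real (card V))"
      have "real (card V) \<le> cycle_const * real r ^ 6 * (1 + ?x) ^ 5 * real (key_count r V)"
        using card_le_if_no_tight_cycle[OF fin \<open>V \<noteq> {}\<close> assms nc refl] .
      then have "real r * real (card V) \<le> real r * (cycle_const * real r ^ 6 * (1 + ?x) ^ 5 * real (key_count r V))"
        by (intro mult_left_mono) auto
      also have "\<dots> = C * (1 + ?x) ^ 5 * real (key_count r V)"
        by (simp add: C_def power_numeral_reduce mult_ac)
      finally have "dens r V \<le> C * (1 + ?x) ^ 5"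
        using P by (simp add: dens divide_le_eq)
      also have "\<dots> \<le> exp (c * sqrt ?x)"
        unfolding c_def using V1 False by (intro polylog_le_exp_sqrt[OF C]) simp
      finally show ?thesis .
    qed
  qed
  ultimately show ?thesis by blast
qed

end
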